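(* Let $n$ be a positive integer. If $E \subseteq \mathbb{R}^n$ is bounded and infinite, then there is a weakly $C^\infty$ arc $A \subseteq \mathbb{R}^n$ such that $E \cap A$ is infinite.
   Context: An arc in $\mathbb{R}^n$ is a set homeomorphic to a closed bounded interval $[a,b] \subset \mathbb{R}$ ($a<b$). A path is a homeomorphism $g$ mapping a compact interval onto an arc; it is a $C^k$ path iff $g$ is a $C^k$ function into $\mathbb{R}^n$ (its derivative is allowed to vanish). For $k \ge 1$, an arc is weakly $C^k$ iff it is the image of a $C^k$ path; it is weakly $C^\infty$ iff it is weakly $C^k$ for all $k$. *)

theory Defs
  imports "HOL-Analysis.Analysis"
begin

text \<open>The library constant \<^const>\<open>arc\<close> is a predicate on injective parametrisations over
  \<open>{0..1}\<close>; here an arc is a point set.\<close>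

definition arc_set :: "'a::topological_space set \<Rightarrow> bool" where
  "arc_set A \<longleftrightarrow> (\<exists>a b::real. a < b \<and> {a..b} homeomorphic A)"

text \<open>For a nondegenerate interval \<open>{a..b}\<close> the derivative within \<open>{a..b}\<close> is unique, and it is
  one-sided at the endpoints. No condition excludes zeros of the derivative.\<close>

primrec Ck_on :: "nat \<Rightarrow> (real \<Rightarrow> 'a::real_normed_vector) \<Rightarrow> real set \<Rightarrow> bool" where
  "Ck_on 0 f S \<longleftrightarrow> continuous_on S f"
| "Ck_on (Suc k) f S \<longleftrightarrow>
     (\<exists>f'. (\<forall>t\<in>S. (f has_vector_derivative f' t) (at t within S)) \<and> Ck_on k f' S)"

definition Ck_path :: "nat \<Rightarrow> real \<Rightarrow> real \<Rightarrow> (real \<Rightarrow> 'a::real_normed_vector) \<Rightarrow> 'a set \<Rightarrow> bool" where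
  "Ck_path k a b g A \<longleftrightarrow>
     a < b \<and> arc_set A \<and> (\<exists>h. homeomorphism {a..b} A g h) \<and> Ck_on k g {a..b}"

definition weakly_Ck_arc :: "nat \<Rightarrow> 'a::real_normed_vector set \<Rightarrow> bool" where
  "weakly_Ck_arc k A \<longleftrightarrow> arc_set A \<and> (\<exists>a b g. Ck_path k a b g A)"

text \<open>The parametrisation may depend on \<open>k\<close>.\<close>

definition weakly_smooth_arc :: "'a::real_normed_vector set \<Rightarrow> bool" where
  "weakly_smooth_arc A \<longleftrightarrow> (\<forall>k\<ge>1. weakly_Ck_arc k A)"

end

theory Submission
  imports Defs "HOL-Computational_Algebra.Polynomial"
begin

text \<open>
  The arc is a polygonal line with infinitely many vertices in \<open>E\<close>, together with the limit of the
  vertices. A coordinate takes infinitely many values on \<open>E\<close>, so by compactness \<open>E\<close> contains a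
  convergent sequence along which this coordinate is strictly monotone
  (\<open>bounded_infinite_imp_monotone_sequence\<close>). Join consecutive terms by segments. The coordinate is
  strictly monotone along the whole line, which therefore does not meet itself.

  Smoothness costs nothing because derivatives may vanish: the parametrisation slows down to a
  complete stop at each vertex. Formally, with \<open>\<tau> k = 1 - 1 / 2 ^ k\<close>, a smooth step rises from \<open>0\<close> to \<open>1\<close>
  on \<open>{\<tau> k..\<tau> (Suc k)}\<close> (\<open>smooth_step_exists\<close>), and the path is \<open>x 0\<close> plus the series of these steps
  times \<open>x (Suc k) - x k\<close>. The steps get steeper and their derivatives larger, but the steps are
  fixed before the vertices are. A subsequence that converges fast enough makes every
  termwise differentiated series uniformly convergent (\<open>Ck_on_smooth_series\<close>), even at the limit
  point \<open>1\<close>. One parametrisation thus serves for all orders of differentiability.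
\<close>

section \<open>Smooth steps\<close>

text \<open>For a polynomial \<open>q\<close> these functions, with \<open>n\<close> and \<open>p\<close> varying, form a family that is closed under
  differentiation and contains \<open>exp (- 1 / q)\<close>, extended by \<open>0\<close> to where \<open>q \<le> 0\<close>. With
  \<open>q = (t - a) * (b - t)\<close> this is a bump on the interval from \<open>a\<close> to \<open>b\<close>.\<close>
definition flat :: "real poly \<Rightarrow> nat \<Rightarrow> real poly \<Rightarrow> real \<Rightarrow> real" where
  "flat q n p t = (if 0 < poly q t then poly p t * inverse (poly q t) ^ n * exp (- inverse (poly q t)) else 0)"

lemma power_le_fact_exp:
  fixes x :: real
  assumes "0 \<le> x"
  shows "x ^ n \<le> fact n * exp x"
proof -
  have "(\<Sum>i\<in>{n}. x ^ i /\<^sub>R fact i) \<le> exp x"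
    using exp_converges[of x] assms by (intro sum_le_suminf[THEN order_trans]) (auto simp: sums_iff)
  then show ?thesis by (simp add: field_simps)
qed

text \<open>The exponential beats every power of \<open>1 / q\<close>. The two factors \<open>q\<close> that are left over give the
  vanishing derivative at the zeros of \<open>q\<close>.\<close>
lemma abs_flat_le: "\<bar>flat q n p t\<bar> \<le> fact (n + 2) * \<bar>poly p t\<bar> * (poly q t)\<^sup>2"
proof (cases "0 < poly q t")
  case True
  define s where "s = poly q t"
  have s: "0 < s" using True by (simp add: s_def)
  have "inverse s ^ (n + 2) \<le> fact (n + 2) * exp (inverse s)"
    using s by (intro power_le_fact_exp) simp
  then have "inverse s ^ (n + 2) * (s\<^sup>2 * exp (- inverse s))
      \<le> (fact (n + 2) * exp (inverse s)) * (s\<^sup>2 * exp (- inverse s))"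
    by (intro mult_right_mono) auto
  also have "inverse s ^ (n + 2) * (s\<^sup>2 * exp (- inverse s)) = inverse s ^ n * exp (- inverse s)"
    using s by (simp add: power2_eq_square field_simps)
  also have "(fact (n + 2) * exp (inverse s)) * (s\<^sup>2 * exp (- inverse s)) = fact (n + 2) * s\<^sup>2"
    by (simp add: exp_minus del: fact_Suc)
  finally have "\<bar>poly p t\<bar> * (inverse s ^ n * exp (- inverse s)) \<le> \<bar>poly p t\<bar> * (fact (n + 2) * s\<^sup>2)"
    by (intro mult_left_mono) auto
  then show ?thesis
    using s by (simp add: flat_def abs_mult s_def mult_ac del: fact_Suc)
qed (auto simp: flat_def)

text \<open>Where \<open>q > 0\<close> this is the product rule, and where \<open>q < 0\<close> the function is locally \<open>0\<close>. At a
  zero \<open>t\<close> of \<open>q\<close> the difference quotient is at most a constant times \<open>\<bar>p\<bar> * \<bar>q\<bar> * \<bar>q / (y - t)\<bar>\<close>,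
  where \<open>q\<close> tends to \<open>0\<close> and the last factor stays bounded.\<close>
lemma flat_has_derivative:
  "(flat q n p has_real_derivative
     flat q (n + 2) (pderiv p * q\<^sup>2 - of_nat n * (p * q * pderiv q) + p * pderiv q) t) (at t)"
proof -
  have cq: "isCont (poly q) t" by simp
  consider "0 < poly q t" | "poly q t < 0" | "poly q t = 0" by linarith
  then show ?thesis
  proof cases
    case 1
    have ev: "\<forall>\<^sub>F y in nhds t. poly p y * inverse (poly q y) ^ n * exp (- inverse (poly q y)) = flat q n p y"
    proof -
      have "\<forall>\<^sub>F y in nhds t. 0 < poly q y"
        using cq 1 by (simp add: isCont_def tendsto_at_iff_tendsto_nhds order_tendstoD)
      then show ?thesis by eventually_elim (simp add: flat_def)
    qed
    have "((\<lambda>y. poly p y * inverse (poly q y) ^ n * exp (- inverse (poly q y))) has_real_derivative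
        flat q (n + 2) (pderiv p * q\<^sup>2 - of_nat n * (p * q * pderiv q) + p * pderiv q) t) (at t)"
    proof -
      define r where "r = inverse (poly q t)"
      have qr: "poly q t * r = 1" using 1 by (simp add: r_def)
      have dr: "((\<lambda>y. inverse (poly q y)) has_real_derivative - (poly (pderiv q) t * r\<^sup>2)) (at t)"
        using DERIV_inverse'[OF poly_DERIV[of q t]] 1
        by (simp add: r_def power2_eq_square mult_ac)
      have dn: "((\<lambda>y. inverse (poly q y) ^ n) has_real_derivative
          - (real n * poly (pderiv q) t * r ^ (n + 1))) (at t)"
        using DERIV_power[OF dr, of n]
        by (cases n) (simp_all add: r_def power2_eq_square mult_ac)
      have de: "((\<lambda>y. exp (- inverse (poly q y))) has_real_derivative
          exp (- r) * (poly (pderiv q) t * r\<^sup>2)) (at t)"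
        using DERIV_fun_exp[OF DERIV_minus[OF dr]] by (simp add: r_def)
      have "(poly p t * r ^ n) * (exp (- r) * (poly (pderiv q) t * r\<^sup>2))
          + (poly p t * - (real n * poly (pderiv q) t * r ^ (n + 1)) + poly (pderiv p) t * r ^ n) * exp (- r)
        = (poly (pderiv p) t * (poly q t * r)\<^sup>2
            - real n * (poly p t * (poly q t * r) * poly (pderiv q) t) * r
            + poly p t * poly (pderiv q) t * r\<^sup>2) * r ^ n * exp (- r)"
        unfolding qr by (simp add: algebra_simps)
      also have "\<dots> = flat q (n + 2)
          (pderiv p * q\<^sup>2 - of_nat n * (p * q * pderiv q) + p * pderiv q) t"
        using 1 by (simp add: flat_def flip: r_def) (simp add: algebra_simps power2_eq_square)
      finally show ?thesis
        using DERIV_mult'[OF DERIV_mult'[OF poly_DERIV[of p t] dn] de]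
        by (simp add: r_def mult_ac add_ac)
    qed
    then show ?thesis by (subst (asm) DERIV_cong_ev[OF refl ev refl])
  next
    case 2
    have ev: "\<forall>\<^sub>F y in nhds t. 0 = flat q n p y"
    proof -
      have "\<forall>\<^sub>F y in nhds t. poly q y < 0"
        using cq 2 by (simp add: isCont_def tendsto_at_iff_tendsto_nhds order_tendstoD)
      then show ?thesis by eventually_elim (simp add: flat_def)
    qed
    have "((\<lambda>y. 0) has_real_derivative
        flat q (n + 2) (pderiv p * q\<^sup>2 - of_nat n * (p * q * pderiv q) + p * pderiv q) t) (at t)"
      using 2 by (simp add: flat_def)
    then show ?thesis by (subst (asm) DERIV_cong_ev[OF refl ev refl])
  next
    case 3
    let ?K = "fact (n + 2) :: real"
    have "((\<lambda>y. (poly q y - poly q t) / (y - t)) \<longlongrightarrow> poly (pderiv q) t) (at t)"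
      using poly_DERIV[of q t] by (simp add: has_field_derivative_iff)
    then have q: "((\<lambda>y. poly q y / (y - t)) \<longlongrightarrow> poly (pderiv q) t) (at t)"
      using 3 by simp
    have "((\<lambda>y. ?K * \<bar>poly p y\<bar> * \<bar>poly q y\<bar> * \<bar>poly q y / (y - t)\<bar>) \<longlongrightarrow>
        ?K * \<bar>poly p t\<bar> * \<bar>poly q t\<bar> * \<bar>poly (pderiv q) t\<bar>) (at t)"
      by (intro tendsto_intros q)
    then have b: "((\<lambda>y. ?K * \<bar>poly p y\<bar> * \<bar>poly q y\<bar> * \<bar>poly q y / (y - t)\<bar>) \<longlongrightarrow> 0) (at t)"
      using 3 by simp
    have "((\<lambda>y. (flat q n p y - flat q n p t) / (y - t)) \<longlongrightarrow> 0) (at t)"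
    proof (rule Lim_null_comparison[OF always_eventually b], rule allI)
      fix y
      have "\<bar>flat q n p y\<bar> / \<bar>y - t\<bar> \<le> ?K * \<bar>poly p y\<bar> * (poly q y)\<^sup>2 / \<bar>y - t\<bar>"
        by (intro divide_right_mono abs_flat_le) simp
      also have "\<dots> = ?K * \<bar>poly p y\<bar> * \<bar>poly q y\<bar> * \<bar>poly q y / (y - t)\<bar>"
        by (subst power2_abs[symmetric]) (simp add: power2_eq_square abs_divide del: fact_Suc)
      finally show "norm ((flat q n p y - flat q n p t) / (y - t)) \<le>
          ?K * \<bar>poly p y\<bar> * \<bar>poly q y\<bar> * \<bar>poly q y / (y - t)\<bar>"
        using 3 by (simp add: flat_def)
    qed
    then show ?thesis
      using 3 by (simp add: has_field_derivative_iff flat_def)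
  qed
qed

text \<open>The \<open>j\<close>-th derivative of the bump \<open>exp (- 1 / q)\<close> is \<open>bump_numerator q j / q ^ (2 * j)\<close> times
  the bump.\<close>
primrec bump_numerator :: "real poly \<Rightarrow> nat \<Rightarrow> real poly" where
  "bump_numerator q 0 = 1"
| "bump_numerator q (Suc j) =
     pderiv (bump_numerator q j) * q\<^sup>2 - of_nat (2 * j) * (bump_numerator q j * q * pderiv q)
       + bump_numerator q j * pderiv q"

lemma bump_has_derivative:
  "(flat q (2 * j) (bump_numerator q j) has_real_derivative
     flat q (2 * Suc j) (bump_numerator q (Suc j)) t) (at t)"
  using flat_has_derivative[of q "2 * j" "bump_numerator q j" t] by simp

text \<open>The step is \<open>D 0\<close>, and \<open>D j\<close> is its \<open>j\<close>-th derivative. All derivatives are part of the data, so that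
  no regularity has to be re-derived when the steps are summed. The strict inequality lets the second
  point lie beyond \<open>b\<close>: wherever \<open>s\<close> is on the slope, the step still rises after \<open>s\<close>.\<close>
definition smooth_step :: "real \<Rightarrow> real \<Rightarrow> (nat \<Rightarrow> real \<Rightarrow> real) \<Rightarrow> bool" where
  "smooth_step a b D \<longleftrightarrow>
     (\<forall>j. \<forall>t\<in>{0..1}. (D j has_real_derivative D (Suc j) t) (at t within {0..1})) \<and>
     (\<forall>t\<in>{0..a}. D 0 t = 0) \<and> (\<forall>t\<in>{b..1}. D 0 t = 1) \<and>
     mono_on {0..1} (D 0) \<and> (\<forall>s\<in>{a..<b}. \<forall>t\<in>{s<..1}. D 0 s < D 0 t)"

text \<open>The step is the normalised antiderivative of the bump on the interval from \<open>a\<close> to \<open>b\<close>. Its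
  monotonicity properties come from the sign of the bump through the mean value theorem.\<close>
lemma smooth_step_exists:
  assumes "0 \<le> a" "a < b" "b \<le> 1"
  shows "\<exists>D. smooth_step a b D"
proof -
  define q where "q = [:- a, 1:] * [:b, - 1:]"
  define B where "B j = flat q (2 * j) (bump_numerator q j)" for j
  have qt: "poly q t = (t - a) * (b - t)" for t by (simp add: q_def del: mult_pCons_left mult_pCons_right)
  have dB: "(B j has_real_derivative B (Suc j) t) (at t within {0..1})" for j t
    unfolding B_def by (rule has_field_derivative_at_within) (rule bump_has_derivative)
  have B_pos: "0 < B 0 t" if "a < t" "t < b" for t
    using that by (simp add: B_def flat_def qt)
  have B_zero: "B 0 t = 0" if "t \<le> a \<or> b \<le> t" for t
    using that assms by (auto simp: B_def flat_def qt zero_less_mult_iff)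
  have "continuous_on {0..1} (B 0)"
    by (rule DERIV_continuous_on) (rule dB)
  then obtain g where g: "\<And>t. t \<in> {0..1} \<Longrightarrow> (g has_vector_derivative B 0 t) (at t within {0..1})"
    using antiderivative_continuous by blast
  have mvt: "\<exists>x\<in>{s<..<t}. g t - g s = (t - s) * B 0 x" if "0 \<le> s" "s < t" "t \<le> 1" for s t
  proof -
    have "\<exists>x\<in>{s<..<t}. g t - g s = (\<lambda>h. h *\<^sub>R B 0 x) (t - s)"
    proof (rule mvt_simple[OF \<open>s < t\<close>])
      fix x assume "s \<le> x" "x \<le> t"
      then show "(g has_derivative (\<lambda>h. h *\<^sub>R B 0 x)) (at x within {s..t})"
        using g[of x] that unfolding has_vector_derivative_def
        by (auto intro: has_derivative_subset)
    qed
    then show ?thesis by simp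
  qed
  have B_nonneg: "0 \<le> B 0 t" for t
    using B_pos[of t] B_zero[of t] by (cases "a < t \<and> t < b") (simp_all add: less_imp_le not_less)
  have mono: "g s \<le> g t" if st: "0 \<le> s" "s \<le> t" "t \<le> 1" for s t
  proof (cases "s = t")
    case False
    then obtain x where "g t - g s = (t - s) * B 0 x" using mvt[of s t] st False by force
    moreover have "0 \<le> (t - s) * B 0 x" using st B_nonneg by simp
    ultimately show ?thesis by linarith
  qed simp
  have const: "g s = g t" if st: "0 \<le> s" "s \<le> t" "t \<le> 1" "t \<le> a \<or> b \<le> s" for s t
  proof (cases "s = t")
    case False
    then obtain x where "x \<in> {s<..<t}" "g t - g s = (t - s) * B 0 x" using mvt[of s t] st False by force
    then show ?thesis using st(4) B_zero[of x] by auto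
  qed simp
  have strict: "g s < g t" if st: "a \<le> s" "s < b" "s < t" "t \<le> 1" for s t
  proof -
    obtain x where "x \<in> {s<..<min b t}" "g (min b t) - g s = (min b t - s) * B 0 x"
      using mvt[of s "min b t"] st assms by force
    moreover from this have "0 < (min b t - s) * B 0 x" using st B_pos[of x] by simp
    ultimately have "g s < g (min b t)" by linarith
    also have "\<dots> \<le> g t" using mono[of "min b t" t] st assms by simp
    finally show ?thesis .
  qed
  define C where "C = g b - g a"
  have C: "0 < C" using strict[of a b] assms by (simp add: C_def)
  define D where "D j = (case j of 0 \<Rightarrow> (\<lambda>t. (g t - g a) / C) | Suc i \<Rightarrow> (\<lambda>t. B i t / C))" for j
  have "smooth_step a b D"
    unfolding smooth_step_def
  proof (intro conjI allI ballI mono_onI)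
    show "(D j has_real_derivative D (Suc j) t) (at t within {0..1})" if "t \<in> {0..1}" for j t
    proof (cases j)
      case 0
      have "(g has_real_derivative B 0 t) (at t within {0..1})"
        using g[OF that] by (simp add: has_real_derivative_iff_has_vector_derivative)
      then show ?thesis using C
        by (auto simp: D_def 0 intro!: derivative_eq_intros)
    next
      case (Suc i)
      then show ?thesis using DERIV_cdivide[OF dB[of i t], of C] by (simp add: D_def)
    qed
    show "D 0 t = 0" if "t \<in> {0..a}" for t
      using const[of t a] that assms by (simp add: D_def)
    show "D 0 t = 1" if "t \<in> {b..1}" for t
      using const[of b t] that assms C by (simp add: D_def C_def)
    show "D 0 s \<le> D 0 t" if "s \<in> {0..1}" "t \<in> {0..1}" "s \<le> t" for s t
      using mono[of s t] that C by (simp add: D_def divide_right_mono)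
    show "D 0 s < D 0 t" if "s \<in> {a..<b}" "t \<in> {s<..1}" for s t
      using strict[of s t] that C by (simp add: D_def divide_strict_right_mono)
  qed
  then show ?thesis by blast
qed

section \<open>Termwise differentiation\<close>

lemma Ck_on_derivative_chain:
  assumes "\<And>j t. t \<in> S \<Longrightarrow> (F j has_vector_derivative F (Suc j) t) (at t within S)"
  shows "Ck_on m (F j) S"
proof (induction m arbitrary: j)
  case 0
  show ?case
    using assms by (auto simp: continuous_on_eq_continuous_within
        intro: has_vector_derivative_continuous)
next
  case (Suc m)
  then show ?case using assms by auto
qed

text \<open>The bound \<open>M k\<close> covers finitely many derivatives of each term, namely those of order \<open>j \<le> k\<close>. For a
  fixed order \<open>j\<close> this leaves out finitely many terms, so the \<open>j\<close>-th derivatives still sum uniformly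
  by the Weierstrass test.\<close>
lemma Ck_on_smooth_series:
  fixes D :: "nat \<Rightarrow> nat \<Rightarrow> real \<Rightarrow> real" and v :: "nat \<Rightarrow> 'a::banach"
  assumes S: "convex S"
    and D: "\<And>k j t. t \<in> S \<Longrightarrow> (D k j has_real_derivative D k (Suc j) t) (at t within S)"
    and le: "\<And>k j t. j \<le> k \<Longrightarrow> t \<in> S \<Longrightarrow> \<bar>D k j t\<bar> * norm (v k) \<le> M k"
    and M: "summable M"
  shows "Ck_on m (\<lambda>t. \<Sum>k. D k 0 t *\<^sub>R v k) S"
proof -
  define F where "F j t = (\<Sum>k. D k j t *\<^sub>R v k)" for j t
  have sums: "(\<lambda>k. D k j t *\<^sub>R v k) sums F j t" if "t \<in> S" for j t
    unfolding F_def
  proof (rule summable_sums, rule summable_comparison_test_ev[OF _ M])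
    show "\<forall>\<^sub>F k in sequentially. norm (D k j t *\<^sub>R v k) \<le> M k"
      using eventually_ge_at_top[of j] by eventually_elim (simp add: le that)
  qed
  have unif: "uniform_limit S (\<lambda>n t. \<Sum>k<n. D k j t *\<^sub>R v k) (F j) sequentially" for j
    unfolding F_def
  proof (rule Weierstrass_m_test_ev[OF _ M])
    show "\<forall>\<^sub>F k in sequentially. \<forall>t\<in>S. norm (D k j t *\<^sub>R v k) \<le> M k"
      using eventually_ge_at_top[of j] by eventually_elim (simp add: le)
  qed
  have "(F j has_vector_derivative F (Suc j) t) (at t within S)" if t: "t \<in> S" for j t
  proof -
    have "\<exists>g. \<forall>x\<in>S. (\<lambda>k. D k j x *\<^sub>R v k) sums g x \<and>
        (g has_derivative (\<lambda>h. h *\<^sub>R F (Suc j) x)) (at x within S)"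
    proof (rule has_derivative_series
          [where f = "\<lambda>k x. D k j x *\<^sub>R v k" and f' = "\<lambda>k x h. h *\<^sub>R (D k (Suc j) x *\<^sub>R v k)",
            OF S _ _ t sums[OF t]])
      show "((\<lambda>x. D k j x *\<^sub>R v k) has_derivative (\<lambda>h. h *\<^sub>R (D k (Suc j) x *\<^sub>R v k)))
          (at x within S)" if "x \<in> S" for k x
        using D[OF that, of k j] unfolding has_vector_derivative_def[symmetric]
        by (auto intro!: derivative_eq_intros)
      fix e :: real assume "0 < e"
      show "\<forall>\<^sub>F n in sequentially. \<forall>x\<in>S. \<forall>h.
          norm ((\<Sum>k<n. h *\<^sub>R (D k (Suc j) x *\<^sub>R v k)) - h *\<^sub>R F (Suc j) x) \<le> e * norm h"
        using uniform_limitD[OF unif[of "Suc j"] \<open>0 < e\<close>]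
      proof eventually_elim
        case (elim n)
        show ?case
        proof (intro ballI allI)
          fix x and h :: real assume "x \<in> S"
          then have "norm ((\<Sum>k<n. D k (Suc j) x *\<^sub>R v k) - F (Suc j) x) \<le> e"
            using elim by (auto simp: dist_norm less_imp_le)
          then have "\<bar>h\<bar> * norm ((\<Sum>k<n. D k (Suc j) x *\<^sub>R v k) - F (Suc j) x) \<le> \<bar>h\<bar> * e"
            by (intro mult_left_mono) auto
          then show "norm ((\<Sum>k<n. h *\<^sub>R (D k (Suc j) x *\<^sub>R v k)) - h *\<^sub>R F (Suc j) x) \<le> e * norm h"
            by (simp only: scaleR_right.sum[symmetric] scaleR_diff_right[symmetric] norm_scaleR
                real_norm_def mult.commute)
        qed
      qed
    qed
    then obtain g where g: "\<And>x. x \<in> S \<Longrightarrow> (\<lambda>k. D k j x *\<^sub>R v k) sums g x"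
      "(g has_derivative (\<lambda>h. h *\<^sub>R F (Suc j) t)) (at t within S)"
      using t by blast
    have "F j x = g x" if "x \<in> S" for x
      using sums_unique2[OF sums g(1)] that by blast
    then show ?thesis
      using g(2) t unfolding has_vector_derivative_def
      by (metis has_derivative_transform)
  qed
  then have "Ck_on m (F 0) S" by (rule Ck_on_derivative_chain)
  then show ?thesis by (simp add: F_def[abs_def])
qed

lemma Ck_on_const_add:
  assumes "Ck_on m f S"
  shows "Ck_on m (\<lambda>t. c + f t) S"
proof (cases m)
  case 0
  then show ?thesis using assms by (simp add: continuous_on_add)
next
  case (Suc k)
  then obtain f' where f': "\<And>t. t \<in> S \<Longrightarrow> (f has_vector_derivative f' t) (at t within S)"
    "Ck_on k f' S"
    using assms by auto
  have "((\<lambda>t. c + f t) has_vector_derivative f' t) (at t within S)" if "t \<in> S" for t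
    using has_vector_derivative_add[OF has_vector_derivative_const f'(1)[OF that]] by simp
  then show ?thesis using Suc f'(2) by auto
qed

lemma Ck_on_imp_continuous_on: "Ck_on m f S \<Longrightarrow> continuous_on S f"
  by (cases m) (auto simp: continuous_on_eq_continuous_within intro: has_vector_derivative_continuous)

section \<open>Arcs through monotone sequences\<close>

lemma Cauchy_fast_subsequence:
  fixes y :: "nat \<Rightarrow> 'a::metric_space"
  assumes "Cauchy y" and eps: "\<And>k. 0 < \<epsilon> k"
  obtains r :: "nat \<Rightarrow> nat" where "strict_mono r" "\<And>k. dist (y (r (Suc k))) (y (r k)) < \<epsilon> k"
proof -
  have "\<exists>N. \<forall>m\<ge>N. \<forall>n\<ge>N. dist (y m) (y n) < \<epsilon> k" for k
    using assms(1) eps[of k] unfolding Cauchy_def by blast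
  then obtain N where N: "\<And>k m n. \<lbrakk>N k \<le> m; N k \<le> n\<rbrakk> \<Longrightarrow> dist (y m) (y n) < \<epsilon> k"
    by metis
  define r where "r k = (\<Sum>i\<le>k. Suc (N i))" for k
  have "N k \<le> r k" for k
    by (cases k) (simp_all add: r_def)
  moreover have "strict_mono r"
    by (simp add: strict_mono_Suc_iff r_def)
  ultimately show thesis
    by (meson N that lessI less_imp_le order_trans strict_mono_less)
qed

text \<open>The path pauses at the vertex \<open>x k\<close> at time \<open>\<tau> k\<close>, when the first \<open>k\<close> steps are complete and the
  others have not begun. Between \<open>\<tau> k\<close> and \<open>\<tau> (Suc k)\<close> only the \<open>k\<close>-th step moves. Paired with
  \<open>e\<close>, every term of the series is nondecreasing in time, and at each time before \<open>1\<close> one of them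
  rises strictly. Hence the path is injective.\<close>
lemma smooth_arc_through_sequence:
  fixes y :: "nat \<Rightarrow> 'a::euclidean_space"
  assumes "Cauchy y" and mono: "\<And>m n. m < n \<Longrightarrow> y m \<bullet> e < y n \<bullet> e"
  shows "\<exists>A. weakly_smooth_arc A \<and> infinite (range y \<inter> A)"
proof -
  define \<tau> :: "nat \<Rightarrow> real" where "\<tau> k = 1 - 1 / 2 ^ k" for k
  have \<tau>0: "\<tau> 0 = 0" by (simp add: \<tau>_def)
  have \<tau>_less: "\<tau> k < \<tau> l" if "k < l" for k l
    using that by (simp add: \<tau>_def field_simps)
  have \<tau>_le: "\<tau> k \<le> \<tau> l" if "k \<le> l" for k l
    using that \<tau>_less[of k l] by (cases "k = l") auto
  have \<tau>_nonneg: "0 \<le> \<tau> k" for k using \<tau>_le[of 0 k] \<tau>0 by simp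
  have \<tau>_1: "\<tau> k \<le> 1" for k by (simp add: \<tau>_def)
  have \<tau>_reach: "\<exists>k. s < \<tau> (Suc k)" if "s < 1" for s
  proof -
    have "\<exists>n. (1 / 2) ^ n < 1 - s"
      using that by (intro real_arch_pow_inv) auto
    then obtain n where "(1 / 2) ^ n < 1 - s" by blast
    then have "s < \<tau> n" by (simp add: \<tau>_def power_divide)
    then show ?thesis using \<tau>_less[of n "Suc n"] by (intro exI[of _ n]) simp
  qed
  have "\<exists>D. smooth_step (\<tau> k) (\<tau> (Suc k)) D" for k
    by (rule smooth_step_exists) (simp_all add: \<tau>_nonneg \<tau>_less \<tau>_1)
  then obtain D where "\<And>k. smooth_step (\<tau> k) (\<tau> (Suc k)) (D k)"
    by metis
  note steps = this[unfolded smooth_step_def]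
  have D: "(D k j has_real_derivative D k (Suc j) t) (at t within {0..1})" if "t \<in> {0..1}" for k j t
    using steps[of k] that by blast
  have D_zero: "D k 0 t = 0" if "0 \<le> t" "t \<le> \<tau> k" for k t
    using steps[of k] that by simp
  have D_one: "D k 0 t = 1" if "\<tau> (Suc k) \<le> t" "t \<le> 1" for k t
    using steps[of k] that by simp
  have D_mono: "D k 0 s \<le> D k 0 t" if "0 \<le> s" "s \<le> t" "t \<le> 1" for k s t
    using steps[of k] that by (auto elim!: mono_onD)
  have D_strict: "D k 0 s < D k 0 t" if "\<tau> k \<le> s" "s < \<tau> (Suc k)" "s < t" "t \<le> 1" for k s t
    using steps[of k] that by simp
  \<comment> \<open>The constant \<open>M k\<close> bounds the derivatives of orders \<open>0\<close> to \<open>k\<close> of the \<open>k\<close>-th step. It depends only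
    on the times \<open>\<tau>\<close>, so the subsequence may be chosen in terms of it.\<close>
  have "\<exists>C>0. \<forall>t\<in>{0..1}. \<bar>D k j t\<bar> \<le> C" for k j
  proof -
    have "continuous_on {0..1} (D k j)" by (rule DERIV_continuous_on) (rule D)
    then have "bounded (D k j ` {0..1})"
      by (intro compact_imp_bounded compact_continuous_image compact_Icc)
    then show ?thesis by (auto simp: bounded_pos)
  qed
  then obtain C where C_pos: "\<And>k j. 0 < C k j"
    and C: "\<And>k j t. t \<in> {0..1} \<Longrightarrow> \<bar>D k j t\<bar> \<le> C k j"
    by metis
  define M where "M k = (\<Sum>j\<le>k. C k j)" for k
  have M_pos: "0 < M k" for k unfolding M_def by (intro sum_pos) (auto simp: C_pos)
  have M: "\<bar>D k j t\<bar> \<le> M k" if "j \<le> k" "t \<in> {0..1}" for k j t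
  proof -
    have "C k j \<le> M k" unfolding M_def
      using that C_pos by (intro member_le_sum) (auto simp: less_imp_le)
    then show ?thesis using C[of t k j] that by simp
  qed
  obtain r where r: "strict_mono r"
    and fast: "\<And>k. dist (y (r (Suc k))) (y (r k)) < (1 / 2) ^ k / M k"
    using Cauchy_fast_subsequence[OF assms(1), of "\<lambda>k. (1 / 2) ^ k / M k"] M_pos by auto
  define x where "x k = y (r k)" for k
  define v where "v k = x (Suc k) - x k" for k
  have v_e: "0 < v k \<bullet> e" for k
    using mono[of "r k" "r (Suc k)"] r
    by (simp add: v_def x_def inner_diff_left strict_mono_less)
  have bound: "\<bar>D k j t\<bar> * norm (v k) \<le> (1 / 2) ^ k" if "j \<le> k" "t \<in> {0..1}" for k j t
  proof -
    have "\<bar>D k j t\<bar> * norm (v k) \<le> M k * ((1 / 2) ^ k / M k)"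
      using M[OF that] fast[of k] M_pos[of k]
      by (intro mult_mono) (auto simp: v_def x_def dist_norm)
    then show ?thesis using M_pos[of k] by simp
  qed
  define g where "g t = x 0 + (\<Sum>k. D k 0 t *\<^sub>R v k)" for t
  have smooth: "Ck_on m g {0..1}" for m
    unfolding g_def[abs_def]
    by (rule Ck_on_const_add, rule Ck_on_smooth_series[where D = D and M = "\<lambda>k. (1 / 2) ^ k"])
      (use D bound in \<open>auto simp: summable_geometric\<close>)
  have summ: "summable (\<lambda>k. D k 0 t *\<^sub>R v k)" if "t \<in> {0..1}" for t
    by (rule summable_comparison_test'[of "\<lambda>k. (1 / 2) ^ k" 0])
      (use bound[of 0 _ t] that in \<open>auto simp: summable_geometric\<close>)
  have g_e: "(\<lambda>k. D k 0 t * (v k \<bullet> e)) sums ((g t - x 0) \<bullet> e)" if "t \<in> {0..1}" for t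
    using bounded_linear.sums[OF bounded_linear_inner_left summable_sums[OF summ[OF that]], of e]
    by (simp add: g_def)
  have g_mono: "g s \<bullet> e < g t \<bullet> e" if "0 \<le> s" "s < t" "t \<le> 1" for s t
  proof -
    \<comment> \<open>The step that is rising at time \<open>s\<close>.\<close>
    define k where "k = (LEAST k. s < \<tau> (Suc k))"
    have "s < 1" using that by simp
    then have k: "s < \<tau> (Suc k)" using \<tau>_reach LeastI_ex unfolding k_def by metis
    have "\<tau> k \<le> s"
    proof (cases k)
      case 0
      then show ?thesis using that \<tau>0 by simp
    next
      case (Suc l)
      then show ?thesis using not_less_Least[of l "\<lambda>k. s < \<tau> (Suc k)"] by (simp add: k_def)
    qed
    then have strict: "D k 0 s < D k 0 t" using D_strict k that by blast
    have sums: "(\<lambda>k. (D k 0 t - D k 0 s) * (v k \<bullet> e)) sums (g t \<bullet> e - g s \<bullet> e)"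
      using sums_diff[OF g_e[of t] g_e[of s]] that by (simp add: algebra_simps)
    have "0 < (\<Sum>k. (D k 0 t - D k 0 s) * (v k \<bullet> e))"
    proof (rule suminf_pos2[where i = k])
      show "0 \<le> (D k 0 t - D k 0 s) * (v k \<bullet> e)" for k
        using D_mono[of s t k] that v_e[of k] by (simp add: less_imp_le)
    qed (use sums strict v_e in \<open>auto simp: sums_iff\<close>)
    then show ?thesis using sums by (simp add: sums_iff)
  qed
  have inj: "inj_on g {0..1}"
  proof (rule linorder_inj_onI)
    fix s t :: real assume "s < t" "s \<in> {0..1}" "t \<in> {0..1}"
    then show "g s \<noteq> g t" using g_mono[of s t] by force
  qed auto
  have hits: "g (\<tau> m) = x m" for m
  proof -
    have "(\<Sum>k. D k 0 (\<tau> m) *\<^sub>R v k) = (\<Sum>k<m. D k 0 (\<tau> m) *\<^sub>R v k)"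
      using D_zero[of "\<tau> m"] \<tau>_nonneg \<tau>_le by (intro suminf_finite) auto
    also have "\<dots> = (\<Sum>k<m. x (Suc k) - x k)"
      using D_one[of _ "\<tau> m"] \<tau>_le \<tau>_1 by (intro sum.cong) (auto simp: v_def Suc_le_eq)
    also have "\<dots> = x m - x 0" by (rule sum_lessThan_telescope)
    finally show ?thesis by (simp add: g_def)
  qed
  have cont: "continuous_on {0..1} g" using smooth Ck_on_imp_continuous_on by blast
  obtain h where h: "homeomorphism {0..1} (g ` {0..1}) g h"
    using homeomorphism_compact[OF compact_Icc cont refl inj] by blast
  have arc: "arc_set (g ` {0..1})"
    unfolding arc_set_def homeomorphic_def using h zero_less_one by blast
  have "weakly_smooth_arc (g ` {0..1})"
    unfolding weakly_smooth_arc_def weakly_Ck_arc_def Ck_path_def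
    using arc h smooth zero_less_one by blast
  moreover have "infinite (range y \<inter> g ` {0..1})"
  proof (rule infinite_super)
    show "range x \<subseteq> range y \<inter> g ` {0..1}"
    proof safe
      fix k
      show "x k \<in> range y" by (simp add: x_def)
      show "x k \<in> g ` {0..1}" using hits[of k] \<tau>_nonneg \<tau>_1 by (intro image_eqI[of _ _ "\<tau> k"]) auto
    qed
    have "inj x"
    proof (rule linorder_injI)
      fix k l :: nat assume "k < l"
      then show "x k \<noteq> x l" using mono[of "r k" "r l"] r by (auto simp: x_def strict_mono_less)
    qed
    then show "infinite (range x)" by (rule range_inj_infinite)
  qed
  ultimately show ?thesis by blast
qed

section \<open>Extracting a monotone sequence\<close>

text \<open>A set with finitely many values in each coordinate lies in a finite grid.\<close>
lemma infinite_imp_infinite_coordinate: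
  fixes E :: "'a::euclidean_space set"
  assumes "infinite E"
  obtains b where "b \<in> Basis" "infinite ((\<lambda>x. x \<bullet> b) ` E)"
proof -
  have "finite E" if fin: "\<And>b. b \<in> Basis \<Longrightarrow> finite ((\<lambda>x. x \<bullet> b) ` E)"
  proof (rule finite_surj)
    show "finite (PiE Basis (\<lambda>b. (\<lambda>x. x \<bullet> b) ` E))"
      using fin by (intro finite_PiE) auto
    show "E \<subseteq> (\<lambda>f. \<Sum>b\<in>Basis. f b *\<^sub>R b) ` PiE Basis (\<lambda>b. (\<lambda>x. x \<bullet> b) ` E)"
    proof
      fix x assume "x \<in> E"
      then show "x \<in> (\<lambda>f. \<Sum>b\<in>Basis. f b *\<^sub>R b) ` PiE Basis (\<lambda>b. (\<lambda>x. x \<bullet> b) ` E)"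
        by (intro image_eqI[of _ _ "restrict (\<lambda>b. x \<bullet> b) Basis"])
          (auto simp: euclidean_representation)
    qed
  qed
  then show thesis using assms that by blast
qed

text \<open>The vector \<open>e\<close> is a basis vector or its negative, whichever makes the monotone subsequence
  increasing.\<close>
lemma bounded_infinite_imp_monotone_sequence:
  fixes E :: "'a::euclidean_space set"
  assumes "bounded E" "infinite E"
  obtains y :: "nat \<Rightarrow> 'a" and e where
    "range y \<subseteq> E" "Cauchy y" "\<And>m n. m < n \<Longrightarrow> y m \<bullet> e < y n \<bullet> e"
proof -
  obtain b where b: "infinite ((\<lambda>x. x \<bullet> b) ` E)"
    using infinite_imp_infinite_coordinate[OF assms(2)] by blast
  then obtain z :: "nat \<Rightarrow> real" where z: "inj z" "range z \<subseteq> (\<lambda>x. x \<bullet> b) ` E"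
    using infinite_countable_subset by blast
  then have "\<forall>n. \<exists>x\<in>E. x \<bullet> b = z n" by (auto simp: image_subset_iff image_iff) metis
  then obtain w where w: "\<And>n. w n \<in> E" "\<And>n. w n \<bullet> b = z n" by metis
  have "bounded (range w)" using assms(1) by (rule bounded_subset) (use w in auto)
  then obtain l r where r: "strict_mono r" "(w \<circ> r) \<longlonglongrightarrow> l"
    using bounded_imp_convergent_subsequence by blast
  obtain f where f: "strict_mono f" "monoseq (\<lambda>n. z (r (f n)))"
    using seq_monosub[of "\<lambda>n. z (r n)"] by blast
  define y where "y = (w \<circ> r) \<circ> f"
  have y: "range y \<subseteq> E" "Cauchy y"
    using w LIMSEQ_subseq_LIMSEQ[OF r(2) f(1)] LIMSEQ_imp_Cauchy by (auto simp: y_def)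
  have ne: "y m \<bullet> b \<noteq> y n \<bullet> b" if "m < n" for m n
    using that z(1) r(1) f(1) by (simp add: y_def w inj_eq strict_mono_eq)
  from f(2) consider "\<And>m n. m \<le> n \<Longrightarrow> y m \<bullet> b \<le> y n \<bullet> b" | "\<And>m n. m \<le> n \<Longrightarrow> y n \<bullet> b \<le> y m \<bullet> b"
    unfolding monoseq_def by (auto simp: y_def w)
  then show thesis
  proof cases
    case 1
    then show thesis using that[of y b] y ne by (simp add: order_less_le)
  next
    case 2
    have "y m \<bullet> (- b) < y n \<bullet> (- b)" if "m < n" for m n
      using 2[of m n] ne[of m n] that by (simp add: order_less_le)
    then show thesis using that[of y "- b"] y by blast
  qed
qed

theorem theorem1p7:
  fixes E :: "(real ^ 'n) set"
  assumes "bounded E" and "infinite E"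
  shows "\<exists>A :: (real ^ 'n) set. weakly_smooth_arc A \<and> infinite (E \<inter> A)"
proof -
  obtain y :: "nat \<Rightarrow> real ^ 'n" and e where y: "range y \<subseteq> E" "Cauchy y"
    "\<And>m n. m < n \<Longrightarrow> y m \<bullet> e < y n \<bullet> e"
    using bounded_infinite_imp_monotone_sequence[OF assms] by blast
  obtain A where "weakly_smooth_arc A" "infinite (range y \<inter> A)"
    using smooth_arc_through_sequence[OF y(2,3)] by blast
  moreover have "range y \<inter> A \<subseteq> E \<inter> A" using y(1) by blast
  ultimately show ?thesis by (meson infinite_super)
qed

end
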